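(* Let $d \ge 1$ be an integer, let $h \ge 4$ be an integer such that a Hadamard matrix of order $h$ exists, and let $n = h+d$. Put $\mu = 1 + \frac{h}{2^h}\binom{h}{h/2}$. Then \[ \mathcal{D}(n) \ge h^{h/2}\mu^d\left(1 - \frac{d^2}{\mu}\right), \] and also \[ \mathcal{R}(n) > \left(\frac{2}{\pi e}\right)^{d/2}\left(1 - d^2\sqrt{\frac{\pi}{2h}}\right). \]
   Context: A Hadamard matrix of order $h$ is an $h\times h$ matrix $A$ with entries in $\{\pm 1\}$ such that $A A^T = hI$. For a positive integer $n$, $\mathcal{D}(n)$ denotes the maximum of $\det(M)$ over all $n\times n$ matrices $M$ with entries in $\{\pm 1\}$, and $\mathcal{R}(n) := \mathcal{D}(n)/n^{n/2}$. *)

theory Defs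
  imports Complex_Main "Jordan_Normal_Form.Determinant"
begin

definition sign_matrices :: "nat \<Rightarrow> real mat set" where
  "sign_matrices n = {M \<in> carrier_mat n n. \<forall>i<n. \<forall>j<n. M $$ (i, j) \<in> {- 1, 1}}"

definition hadamard_matrix :: "nat \<Rightarrow> real mat \<Rightarrow> bool" where
  "hadamard_matrix h A \<longleftrightarrow>
     A \<in> sign_matrices h \<and> A * transpose_mat A = real h \<cdot>\<^sub>m 1\<^sub>m h"

definition max_det :: "nat \<Rightarrow> real" where
  "max_det n = Max (det ` sign_matrices n)"

definition max_det_ratio :: "nat \<Rightarrow> real" where
  "max_det_ratio n = max_det n / real n powr (real n / 2)"

text \<open>The two facts below ensure that the maximum in the definition of \<open>max_det\<close> exists.\<close>

lemma finite_sign_matrices: "finite (sign_matrices n)"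
proof -
  let ?F = "({0..<n} \<times> {0..<n}) \<rightarrow>\<^sub>E {- 1, 1 :: real}"
  have "M \<in> mat n n ` ?F" if "M \<in> sign_matrices n" for M
  proof (rule image_eqI)
    show "M = mat n n (restrict (($$) M) ({0..<n} \<times> {0..<n}))"
      using that by (intro eq_matI) (auto simp: sign_matrices_def)
    show "restrict (($$) M) ({0..<n} \<times> {0..<n}) \<in> ?F"
      using that unfolding sign_matrices_def restrict_PiE_iff by fastforce
  qed
  then have "sign_matrices n \<subseteq> mat n n ` ?F" by blast
  moreover have "finite ?F" by (intro finite_PiE) auto
  ultimately show ?thesis by (meson finite_imageI finite_subset)
qed

lemma sign_matrices_nonempty: "sign_matrices n \<noteq> {}"
proof -
  have "mat n n (\<lambda>_. 1) \<in> sign_matrices n" by (simp add: sign_matrices_def)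
  then show ?thesis by blast
qed

end

theory Submission
  imports "HOL-Analysis.Gamma_Function" "HOL-Combinatorics.Transposition" Defs
begin

text \<open>
  Let \<open>A\<close> be any sign matrix of order \<open>n\<close>, \<open>b\<close> a uniformly random sign vector and \<open>c\<^sub>k\<close> the sign
  of the inner product of \<open>b\<close> with the \<open>k\<close>-th column of \<open>A\<close>. Bordering \<open>A\<close> by the column \<open>b\<close>, the
  row \<open>- c\<close> and the corner \<open>1\<close> gives determinant \<open>det A + c adj(A) b\<close>. By symmetry
  \<open>E (c\<^sub>k b\<^sub>m) = A\<^sub>m\<^sub>k e\<^sub>n / n\<close>, where \<open>e\<^sub>n\<close> is the mean absolute value of a sum of \<open>n\<close> random signs, and
  since \<open>tr (adj(A) A) = n det A\<close> the expected determinant is \<open>(1 + e\<^sub>n) det A\<close>. As \<open>e\<^sub>n\<close> is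
  nondecreasing, bordering a Hadamard matrix \<open>d\<close> times yields \<open>D(h + d) \<ge> h\<^bsup>h/2\<^esup> (1 + e\<^sub>h)\<^bsup>d\<^esup>\<close>, which is
  stronger than the first claim because \<open>1 + e\<^sub>h \<ge> \<mu>\<close>. The second claim follows from
  \<open>1 + e\<^sub>h > sqrt (2 h / \<pi>)\<close>, a consequence of the monotonicity of the Wallis product.
\<close>

section \<open>Random sign vectors and the symmetry of their sums\<close>

definition flip_sign :: "nat set \<Rightarrow> nat \<Rightarrow> real" where
  "flip_sign K i = (if i \<in> K then - 1 else 1)"

text \<open>The quantity \<open>e\<^sub>n\<close> above: the expected distance of a simple random
  walk from its start. A sign vector is encoded by the set \<open>K\<close> of its negative
  coordinates, so an expectation is a sum over \<open>Pow {..<n}\<close> divided by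
  \<open>2 ^ n\<close>.\<close>

definition mean_abs_walk :: "nat \<Rightarrow> real" where
  "mean_abs_walk n = (\<Sum>K\<in>Pow {..<n}. \<bar>\<Sum>i<n. flip_sign K i\<bar>) / 2 ^ n"

lemma flip_sign_cases: "flip_sign K i \<in> {- 1, 1}"
  by (simp add: flip_sign_def)

lemma sum_flip_sign:
  assumes "K \<subseteq> {..<n}"
  shows "(\<Sum>i<n. flip_sign K i) = real n - 2 * real (card K)"
proof -
  have "(\<Sum>i<n. flip_sign K i) = (\<Sum>i<n. 1 - 2 * (if i \<in> K then 1 else 0))"
    by (intro sum.cong) (auto simp: flip_sign_def)
  also have "\<dots> = real n - 2 * real (card ({..<n} \<inter> K))"
    by (simp add: sum_subtractf sum.If_cases flip: sum_distrib_left)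
  also have "{..<n} \<inter> K = K" using assms by blast
  finally show ?thesis .
qed

text \<open>Swapping coordinates \<open>m\<close> and \<open>m'\<close> permutes the sign vectors
  and preserves the size of \<open>K\<close>, hence the total on which \<open>g\<close>
  depends.\<close>

lemma sum_flip_sign_transpose:
  fixes g :: "real \<Rightarrow> real"
  assumes "m < n" "m' < n"
  shows "(\<Sum>K\<in>Pow {..<n}. g (\<Sum>i<n. flip_sign K i) * flip_sign K m) =
    (\<Sum>K\<in>Pow {..<n}. g (\<Sum>i<n. flip_sign K i) * flip_sign K m')"
proof -
  let ?t = "Transposition.transpose m m'"
  have img: "?t ` K \<in> Pow {..<n}" if "K \<in> Pow {..<n}" for K
    using that assms by (auto simp: Transposition.transpose_def)
  have summand: "g (\<Sum>i<n. flip_sign (?t ` K) i) * flip_sign (?t ` K) m' =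
      g (\<Sum>i<n. flip_sign K i) * flip_sign K m" if K: "K \<in> Pow {..<n}" for K
  proof -
    have "card (?t ` K) = card K"
      by (simp add: card_image)
    moreover have "flip_sign (?t ` K) m' = flip_sign K m"
      by (simp add: flip_sign_def) (metis imageE image_eqI transpose_apply_first transpose_involutory)
    ultimately show ?thesis
      using K img[OF K] by (simp add: sum_flip_sign)
  qed
  show ?thesis
    by (rule sum.reindex_bij_witness[where i = "image ?t" and j = "image ?t"])
      (use img summand in \<open>simp_all add: image_image\<close>)
qed

text \<open>Unlike \<open>sgn\<close>, this is 1 at 0: its values must be admissible matrix
  entries.\<close>

definition sign1 :: "real \<Rightarrow> real" where
  "sign1 x = (if x \<ge> 0 then 1 else - 1)"

text \<open>By symmetry all coordinates have the same correlation with the sign of the total, and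
  these correlations add up to the mean of the total times its own sign.\<close>

lemma sum_sign1_flip_sign:
  assumes "m < n"
  shows "real n * (\<Sum>K\<in>Pow {..<n}. sign1 (\<Sum>i<n. flip_sign K i) * flip_sign K m) =
    2 ^ n * mean_abs_walk n"
proof -
  let ?S = "\<lambda>K. \<Sum>i<n. flip_sign K i"
  have "real n * (\<Sum>K\<in>Pow {..<n}. sign1 (?S K) * flip_sign K m) =
      (\<Sum>m'<n. \<Sum>K\<in>Pow {..<n}. sign1 (?S K) * flip_sign K m)"
    by simp
  also have "\<dots> = (\<Sum>m'<n. \<Sum>K\<in>Pow {..<n}. sign1 (?S K) * flip_sign K m')"
    using assms by (intro sum.cong[OF refl] sum_flip_sign_transpose) simp_all
  also have "\<dots> = (\<Sum>K\<in>Pow {..<n}. sign1 (?S K) * ?S K)"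
    by (subst sum.swap) (simp add: sum_distrib_left)
  also have "\<dots> = (\<Sum>K\<in>Pow {..<n}. \<bar>?S K\<bar>)"
    by (intro sum.cong) (auto simp: sign1_def)
  finally show ?thesis by (simp add: mean_abs_walk_def)
qed

text \<open>Multiplying sign vectors coordinatewise by \<open>a\<close> is a bijection, realised on
  index sets as symmetric difference with \<open>J\<close>. It turns the inner product into the
  plain total and leaves the factor \<open>a m\<close>.\<close>

lemma sum_sign1_column:
  assumes a: "\<And>i. i < n \<Longrightarrow> a i \<in> {- 1, 1 :: real}" and m: "m < n"
  shows "real n * (\<Sum>K\<in>Pow {..<n}. sign1 (\<Sum>i<n. a i * flip_sign K i) * flip_sign K m) =
    a m * (2 ^ n * mean_abs_walk n)"
proof -
  define J where "J = {i. i < n \<and> a i = - 1}"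
  have flip: "flip_sign (sym_diff K J) i = a i * flip_sign K i" if "i < n" for K i
    using a[OF that] that by (auto simp: flip_sign_def J_def)
  have aa: "a i * a i = 1" if "i < n" for i
    using a[OF that] by auto
  have "(\<Sum>K\<in>Pow {..<n}. sign1 (\<Sum>i<n. a i * flip_sign K i) * flip_sign K m) =
      (\<Sum>K\<in>Pow {..<n}. a m * (sign1 (\<Sum>i<n. flip_sign K i) * flip_sign K m))"
  proof (rule sum.reindex_bij_witness[where i = "\<lambda>K. sym_diff K J" and j = "\<lambda>K. sym_diff K J"])
    fix K assume "K \<in> Pow {..<n}"
    have "(\<Sum>i<n. flip_sign (sym_diff K J) i) = (\<Sum>i<n. a i * flip_sign K i)"
      by (intro sum.cong) (simp_all add: flip)
    then show "a m * (sign1 (\<Sum>i<n. flip_sign (sym_diff K J) i) * flip_sign (sym_diff K J) m) =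
        sign1 (\<Sum>i<n. a i * flip_sign K i) * flip_sign K m"
      using aa[OF m] by (simp add: flip m)
  qed (auto simp: J_def)
  then show ?thesis
    using sum_sign1_flip_sign[OF m] by (simp add: mult.left_commute flip: sum_distrib_left)
qed

section \<open>Determinants of bordered sign matrices\<close>

lemma det_bordered:
  fixes A :: "'a :: idom mat"
  assumes A: "A \<in> carrier_mat n n" and "det A \<noteq> 0"
  shows "det (four_block_mat A (mat n 1 (\<lambda>(i, _). b i)) (mat 1 n (\<lambda>(_, j). - c j)) (1\<^sub>m 1)) =
    det A + (\<Sum>k<n. \<Sum>m<n. c k * adj_mat A $$ (k, m) * b m)"
proof -
  define B where "B = mat n 1 (\<lambda>(i, _). b i)"
  define C where "C = mat 1 n (\<lambda>(_, j). c j)"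
  define M where "M = four_block_mat A B (- C) (1\<^sub>m 1)"
  \<comment> \<open>A Schur complement without inverting \<open>A\<close>: since
    \<open>adj_mat A * A\<close> is \<open>det A\<close> times the identity, multiplication by
    \<open>L\<close> clears the lower left block \<open>- C\<close>. The factor
    \<open>det L = det A\<close> is nonzero and cancels.\<close>
  define L where "L = four_block_mat (1\<^sub>m n) (0\<^sub>m n 1) (C * adj_mat A) (det A \<cdot>\<^sub>m 1\<^sub>m 1)"
  note adj = adj_mat[OF A]
  have B: "B \<in> carrier_mat n 1" and C: "C \<in> carrier_mat 1 n" by (auto simp: B_def C_def)
  have CA: "C * adj_mat A \<in> carrier_mat 1 n" using C adj by auto
  have "C * adj_mat A * A = det A \<cdot>\<^sub>m C"
    using C adj A by (simp add: assoc_mult_mat[of _ 1 n _ n _ n] mult_smult_distrib[OF C one_carrier_mat])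
  then have "C * adj_mat A * A + (det A \<cdot>\<^sub>m 1\<^sub>m 1) * (- C) = 0\<^sub>m 1 n"
    using C by (intro eq_matI) (auto simp: scalar_prod_def)
  then have "L * M = four_block_mat A B (0\<^sub>m 1 n) (C * adj_mat A * B + det A \<cdot>\<^sub>m 1\<^sub>m 1)"
    unfolding L_def M_def using A B C CA
    by (subst mult_four_block_mat[of _ n n _ 1 _ 1 _ _ n _ 1]) auto
  then have "det (L * M) = det A * det (C * adj_mat A * B + det A \<cdot>\<^sub>m 1\<^sub>m 1)"
    using A B CA by (simp add: det_four_block_mat_lower_left_zero[of _ n _ 1])
  moreover have "det L = det A"
    unfolding L_def using CA
    by (subst det_four_block_mat_upper_right_zero[of _ n _ 1]) (auto simp: det_single)
  moreover have "M \<in> carrier_mat (n + 1) (n + 1)" "L \<in> carrier_mat (n + 1) (n + 1)"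
    unfolding M_def L_def using A by auto
  ultimately have "det M = det (C * adj_mat A * B + det A \<cdot>\<^sub>m 1\<^sub>m 1)"
    using \<open>det A \<noteq> 0\<close> by (simp add: det_mult)
  also have "\<dots> = (C * adj_mat A * B) $$ (0, 0) + det A"
    using CA B by (subst det_single) auto
  also have "(C * adj_mat A * B) $$ (0, 0) = (\<Sum>m<n. (\<Sum>k<n. c k * adj_mat A $$ (k, m)) * b m)"
    using adj(1) CA B C
    by (auto simp: scalar_prod_def B_def C_def lessThan_atLeast0 intro!: sum.cong)
  also have "\<dots> = (\<Sum>k<n. \<Sum>m<n. c k * adj_mat A $$ (k, m) * b m)"
    by (subst sum.swap) (simp add: sum_distrib_right)
  finally have "det M = det A + (\<Sum>k<n. \<Sum>m<n. c k * adj_mat A $$ (k, m) * b m)"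
    by simp
  moreover have "- C = mat 1 n (\<lambda>(_, j). - c j)"
    by (auto simp: C_def)
  ultimately show ?thesis by (simp add: M_def B_def)
qed

text \<open>First moment argument: if every choice of the border fell short of the bound, so would
  the average determinant, yet that average equals the bound.\<close>

lemma exists_bordered_sign_matrix:
  assumes A: "A \<in> sign_matrices n" and det: "det A \<noteq> 0"
  shows "\<exists>M\<in>sign_matrices (Suc n). (1 + mean_abs_walk n) * det A \<le> det M"
proof (rule ccontr)
  assume neg: "\<not> ?thesis"
  have A': "A \<in> carrier_mat n n" using A by (simp add: sign_matrices_def)
  define c where "c K k = sign1 (\<Sum>i<n. A $$ (i, k) * flip_sign K i)" for K k
  define M where "M K = four_block_mat A (mat n 1 (\<lambda>(i, _). flip_sign K i))
      (mat 1 n (\<lambda>(_, j). - c K j)) (1\<^sub>m 1)" for K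
  have M: "M K \<in> sign_matrices (Suc n)" for K
  proof -
    have c: "- c K j \<in> {- 1, 1}" for j by (simp add: c_def sign1_def)
    have "M K $$ (i, j) = (if i < n then if j < n then A $$ (i, j) else flip_sign K i
        else if j < n then - c K j else 1)" if "i < Suc n" "j < Suc n" for i j
      using A' that by (simp add: M_def)
    moreover have "M K \<in> carrier_mat (Suc n) (Suc n)"
      unfolding M_def using four_block_carrier_mat[OF A', of "1\<^sub>m 1" 1 1] by simp
    ultimately show ?thesis
      using A c flip_sign_cases[of K] unfolding sign_matrices_def by fastforce
  qed
  have det_M: "det (M K) = det A + (\<Sum>k<n. \<Sum>m<n. c K k * adj_mat A $$ (k, m) * flip_sign K m)" for K
    unfolding M_def by (rule det_bordered[OF A' det])
  have corr: "real n * (\<Sum>K\<in>Pow {..<n}. c K k * flip_sign K m) = A $$ (m, k) * (2 ^ n * mean_abs_walk n)"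
    if "k < n" "m < n" for k m
    unfolding c_def using A that by (intro sum_sign1_column) (auto simp: sign_matrices_def)
  have tr: "(\<Sum>m<n. adj_mat A $$ (k, m) * A $$ (m, k)) = det A" if k: "k < n" for k
  proof -
    have "(adj_mat A * A) $$ (k, k) = (\<Sum>m<n. adj_mat A $$ (k, m) * A $$ (m, k))"
      using k A' adj_mat(1)[OF A'] by (simp add: scalar_prod_def lessThan_atLeast0)
    then show ?thesis using k by (simp add: adj_mat(3)[OF A'])
  qed
  have "(\<Sum>K\<in>Pow {..<n}. det (M K)) = 2 ^ n * (1 + mean_abs_walk n) * det A"
  \<comment> \<open>The correlations are known only after multiplication by \<open>n\<close>, so
    \<open>n = 0\<close> is computed directly and otherwise \<open>n\<close> is cancelled at the
    end.\<close>
  proof (cases "n = 0")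
    case True
    then show ?thesis
      by (simp add: det_M mean_abs_walk_def)
  next
    case False
    have "real n * (\<Sum>K\<in>Pow {..<n}. det (M K)) = real n * (2 ^ n * det A) +
        real n * (\<Sum>K\<in>Pow {..<n}. \<Sum>k<n. \<Sum>m<n. c K k * adj_mat A $$ (k, m) * flip_sign K m)"
      by (simp add: det_M sum.distrib card_Pow distrib_left)
    also have "(\<Sum>K\<in>Pow {..<n}. \<Sum>k<n. \<Sum>m<n. c K k * adj_mat A $$ (k, m) * flip_sign K m) =
        (\<Sum>k<n. \<Sum>m<n. adj_mat A $$ (k, m) * (\<Sum>K\<in>Pow {..<n}. c K k * flip_sign K m))"
      by (subst sum.swap, intro sum.cong refl, subst sum.swap)
        (simp add: sum_distrib_left mult_ac)
    also have "real n * \<dots> =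
        (\<Sum>k<n. \<Sum>m<n. adj_mat A $$ (k, m) * (real n * (\<Sum>K\<in>Pow {..<n}. c K k * flip_sign K m)))"
      by (simp add: sum_distrib_left mult_ac)
    also have "\<dots> = (\<Sum>k<n. \<Sum>m<n. (2 ^ n * mean_abs_walk n) * (adj_mat A $$ (k, m) * A $$ (m, k)))"
      by (intro sum.cong refl) (simp add: corr)
    also have "\<dots> = real n * (2 ^ n * mean_abs_walk n * det A)"
      by (simp add: tr flip: sum_distrib_left)
    finally have "real n * (\<Sum>K\<in>Pow {..<n}. det (M K)) =
        real n * (2 ^ n * (1 + mean_abs_walk n) * det A)"
      by (simp add: algebra_simps)
    then show ?thesis using False by simp
  qed
  moreover have "(\<Sum>K\<in>Pow {..<n}. det (M K)) < (\<Sum>K\<in>Pow {..<n}. (1 + mean_abs_walk n) * det A)"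
    using neg M by (intro sum_strict_mono) (auto simp: not_le)
  ultimately show False by (simp add: card_Pow)
qed

section \<open>Growth of the maximal determinant under bordering\<close>

lemma det_le_max_det: "M \<in> sign_matrices n \<Longrightarrow> det M \<le> max_det n"
  by (simp add: max_det_def finite_sign_matrices)

lemma max_det_attained: "\<exists>M\<in>sign_matrices n. det M = max_det n"
proof -
  have "max_det n \<in> det ` sign_matrices n"
    unfolding max_det_def
    by (rule Max_in) (simp_all add: finite_sign_matrices sign_matrices_nonempty)
  then show ?thesis by auto
qed

lemma mean_abs_walk_nonneg: "0 \<le> mean_abs_walk n"
  by (simp add: mean_abs_walk_def sum_nonneg)

lemma max_det_Suc:
  assumes "0 < max_det n"
  shows "(1 + mean_abs_walk n) * max_det n \<le> max_det (Suc n)"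
proof -
  obtain A where A: "A \<in> sign_matrices n" "det A = max_det n"
    using max_det_attained by blast
  then obtain M where "M \<in> sign_matrices (Suc n)" "(1 + mean_abs_walk n) * max_det n \<le> det M"
    using exists_bordered_sign_matrix[of A n] assms by auto
  then show ?thesis using det_le_max_det by fastforce
qed

text \<open>Condition on the last sign: a total S becomes S + 1 (sets avoiding \<open>n\<close>) or
  S - 1 (sets containing \<open>n\<close>), and |S + 1| + |S - 1| is at least 2 |S|.\<close>

lemma mean_abs_walk_Suc: "mean_abs_walk n \<le> mean_abs_walk (Suc n)"
proof -
  let ?S = "\<lambda>K. \<Sum>i<n. flip_sign K i"
  have same: "?S (insert n K) = ?S K" for K
    by (intro sum.cong) (auto simp: flip_sign_def)
  have out: "(\<Sum>i<Suc n. flip_sign K i) = ?S K + 1" if "K \<in> Pow {..<n}" for K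
    using that by (auto simp: flip_sign_def[of K n])
  have ins: "(\<Sum>i<Suc n. flip_sign (insert n K) i) = ?S K - 1" for K
    unfolding sum.lessThan_Suc same by (simp add: flip_sign_def[of _ n])
  have inj: "inj_on (insert n) (Pow {..<n})"
  proof (rule inj_onI)
    fix K L assume "K \<in> Pow {..<n}" "L \<in> Pow {..<n}" "insert n K = insert n L"
    then show "K = L" using insert_ident[of n K L] by blast
  qed
  have "Pow {..<n} \<inter> insert n ` Pow {..<n} = {}"
    by blast
  then have "(\<Sum>K\<in>Pow {..<Suc n}. \<bar>\<Sum>i<Suc n. flip_sign K i\<bar>) =
      (\<Sum>K\<in>Pow {..<n}. \<bar>\<Sum>i<Suc n. flip_sign K i\<bar>) +
      (\<Sum>K\<in>insert n ` Pow {..<n}. \<bar>\<Sum>i<Suc n. flip_sign K i\<bar>)"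
    unfolding lessThan_Suc[of n] Pow_insert by (intro sum.union_disjoint) simp_all
  also have "(\<Sum>K\<in>Pow {..<n}. \<bar>\<Sum>i<Suc n. flip_sign K i\<bar>) = (\<Sum>K\<in>Pow {..<n}. \<bar>?S K + 1\<bar>)"
    by (intro sum.cong refl arg_cong[of _ _ abs] out)
  also have "(\<Sum>K\<in>insert n ` Pow {..<n}. \<bar>\<Sum>i<Suc n. flip_sign K i\<bar>) = (\<Sum>K\<in>Pow {..<n}. \<bar>?S K - 1\<bar>)"
    by (simp only: sum.reindex[OF inj] o_def ins)
  also have "(\<Sum>K\<in>Pow {..<n}. \<bar>?S K + 1\<bar>) + \<dots> = (\<Sum>K\<in>Pow {..<n}. \<bar>?S K + 1\<bar> + \<bar>?S K - 1\<bar>)"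
    by (simp add: sum.distrib)
  also have "\<dots> \<ge> (\<Sum>K\<in>Pow {..<n}. 2 * \<bar>?S K\<bar>)"
    by (intro sum_mono) linarith
  finally show ?thesis
    by (simp add: mean_abs_walk_def field_simps flip: sum_distrib_left)
qed

lemma max_det_add:
  assumes "0 < max_det h"
  shows "max_det h * (1 + mean_abs_walk h) ^ d \<le> max_det (h + d)"
proof (induction d)
  case (Suc d)
  have pos: "0 < max_det (h + d)"
    using Suc assms mean_abs_walk_nonneg[of h]
    by (smt (verit) mult_pos_pos zero_less_power)
  \<comment> \<open>The factor gained at order \<open>h + d\<close> belongs to that order;
    monotonicity lets the factor of order \<open>h\<close> serve at every stage.\<close>
  have mono: "mean_abs_walk h \<le> mean_abs_walk (h + d)"
    by (rule lift_Suc_mono_le) (simp_all add: mean_abs_walk_Suc)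
  have "max_det h * (1 + mean_abs_walk h) ^ Suc d \<le> max_det (h + d) * (1 + mean_abs_walk h)"
    using Suc mean_abs_walk_nonneg[of h] by (simp add: mult.assoc mult_right_mono flip: mult.commute[of "_ ^ d"])
  also have "\<dots> \<le> max_det (h + d) * (1 + mean_abs_walk (h + d))"
    using pos mono by (intro mult_left_mono) auto
  also have "\<dots> \<le> max_det (h + Suc d)"
    using max_det_Suc[OF pos] by (simp add: mult.commute)
  finally show ?case .
qed simp

lemma max_det_hadamard:
  assumes "hadamard_matrix h A" "0 < h"
  shows "real h powr (real h / 2) \<le> max_det h"
proof -
  have A: "A \<in> sign_matrices h" and A': "A \<in> carrier_mat h h"
    and AAt: "A * transpose_mat A = real h \<cdot>\<^sub>m 1\<^sub>m h"
    using assms(1) by (auto simp: hadamard_matrix_def sign_matrices_def)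
  have "det A * det A = det (A * transpose_mat A)"
    using A' by (simp add: det_mult[of _ h] det_transpose)
  also have "\<dots> = real h ^ h"
    by (simp add: AAt)
  also have "\<dots> = (real h powr (real h / 2))\<^sup>2"
    using assms(2) by (simp add: power2_eq_square powr_realpow flip: powr_add)
  finally have "(det A)\<^sup>2 = (real h powr (real h / 2))\<^sup>2"
    by (simp add: power2_eq_square)
  then have "\<bar>det A\<bar> = real h powr (real h / 2)"
    by (auto simp: power2_eq_iff)
  moreover have "\<bar>det A\<bar> \<le> max_det h"
  proof -
    \<comment> \<open>The Hadamard equation fixes the determinant only up to sign; negating the top
      row covers the negative case.\<close>
    have "multrow 0 (- 1) A \<in> sign_matrices h"
      using A unfolding sign_matrices_def by fastforce
    then have "- det A \<le> max_det h"
      using det_le_max_det[of "multrow 0 (- 1) A" h] det_multrow[OF assms(2) A'] by simp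
    then show ?thesis using det_le_max_det[OF A] by simp
  qed
  ultimately show ?thesis by simp
qed

section \<open>The mean absolute walk and the central binomial coefficient\<close>

lemma sum_Pow_card:
  fixes g :: "nat \<Rightarrow> real"
  shows "(\<Sum>K\<in>Pow {..<n}. g (card K)) = (\<Sum>k\<le>n. real (n choose k) * g k)"
proof -
  have "card K \<le> n" if "K \<subseteq> {..<n}" for K
    using card_mono[OF _ that] by simp
  then have "(\<Sum>K\<in>Pow {..<n}. g (card K)) = (\<Sum>k\<le>n. \<Sum>K\<in>{K \<in> Pow {..<n}. card K = k}. g (card K))"
    by (intro sum.group[symmetric]) auto
  also have "\<dots> = (\<Sum>k\<le>n. real (n choose k) * g k)"
    using n_subsets[of "{..<n}"] by (intro sum.cong) simp_all
  finally show ?thesis .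
qed

text \<open>Bound the absolute values below by \<open>x k\<close> for \<open>k \<le> m\<close> and
  by \<open>- x k\<close> beyond; partial sums of \<open>x\<close> have a closed form.\<close>

lemma mean_abs_walk_ge:
  assumes "0 < n"
  shows "2 * real (n - n div 2) * real (n choose (n div 2)) \<le> 2 ^ n * mean_abs_walk n"
proof -
  define x where "x k = real (n choose k) * (real n - 2 * real k)" for k
  have partial: "(\<Sum>k\<le>m. x k) = (real m + 1) * real (n choose (m + 1))" for m
  proof -
    have "(\<Sum>k\<le>m. x k) = 2 * (\<Sum>k\<le>m. (real n gchoose k) * (real n / 2 - real k))"
      by (simp add: x_def binomial_gbinomial sum_distrib_left algebra_simps)
    then show ?thesis
      by (simp add: gbinomial_partial_row_sum binomial_gbinomial)
  qed
  \<comment> \<open>The condition \<open>k \<le> m\<close> means \<open>2 * k < n\<close>, so the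
    signs change at the cut-off, and \<open>m + 1\<close> is half of \<open>n\<close> rounded up,
    where the closed form yields the central coefficient.\<close>
  define m where "m = n - n div 2 - 1"
  have m: "m < n" "m + 1 = n - n div 2" using assms by (auto simp: m_def)
  have "n choose (m + 1) = n choose (n div 2)"
    using binomial_symmetric[of "n div 2" n] by (simp only: m(2) div_le_dividend)
  \<comment> \<open>The sum up to \<open>n\<close> vanishes because
    \<open>n choose (n + 1) = 0\<close>; subtracting it turns twice the lower part into lower part
    minus upper part.\<close>
  then have "2 * real (n - n div 2) * real (n choose (n div 2)) = 2 * (\<Sum>k\<le>m. x k) - (\<Sum>k\<le>n. x k)"
    using m(2) by (simp add: partial algebra_simps flip: of_nat_Suc)
  also have "(\<Sum>k\<le>n. x k) = (\<Sum>k\<le>m. x k) + (\<Sum>k\<in>{m<..n}. x k)"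
    using m(1) by (subst sum.union_disjoint[symmetric]) (auto intro!: sum.cong)
  also have "2 * (\<Sum>k\<le>m. x k) - \<dots> = (\<Sum>k\<le>m. x k) + (\<Sum>k\<in>{m<..n}. - x k)"
    by (simp add: sum_negf)
  also have "\<dots> \<le> (\<Sum>k\<le>m. \<bar>x k\<bar>) + (\<Sum>k\<in>{m<..n}. \<bar>x k\<bar>)"
    by (intro add_mono sum_mono) auto
  also have "\<dots> = (\<Sum>k\<le>n. \<bar>x k\<bar>)"
    using m(1) by (subst sum.union_disjoint[symmetric]) (auto intro!: sum.cong)
  also have "\<dots> = (\<Sum>k\<le>n. real (n choose k) * \<bar>real n - 2 * real k\<bar>)"
    by (simp add: x_def abs_mult)
  also have "\<dots> = (\<Sum>K\<in>Pow {..<n}. \<bar>\<Sum>i<n. flip_sign K i\<bar>)"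
    by (simp add: sum_Pow_card[symmetric] sum_flip_sign)
  finally show ?thesis by (simp add: mean_abs_walk_def)
qed

section \<open>Central binomial coefficients and the Wallis product\<close>

lemma Suc_times_central_binomial:
  "Suc m * (2 * Suc m choose Suc m) = 2 * (2 * m + 1) * (2 * m choose m)"
proof -
  have "Suc m * (Suc (2 * m + 1) choose Suc m) = Suc (2 * m + 1) * (2 * m + 1 choose m)"
    by (rule Suc_times_binomial)
  also have "\<dots> = 2 * (Suc m * (2 * m + 1 choose m))"
    by simp
  also have "Suc m * (2 * m + 1 choose m) = (2 * m + 1) * (2 * m choose m)"
    using binomial_absorb_comp[of "2 * m + 1" m] by simp
  finally show ?thesis by (simp add: mult_ac)
qed

text \<open>The recurrence of the central coefficient matches the next Wallis factor. An upper bound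
  on the product thereby becomes a lower bound on the coefficient.\<close>

lemma wallis_product_central_binomial:
  "(\<Prod>k=1..m. (4 * real k ^ 2) / (4 * real k ^ 2 - 1)) *
    (real (2 * m choose m) ^ 2 * (2 * real m + 1)) = 16 ^ m"
proof (induction m)
  case (Suc m)
  define P where "P = (\<Prod>k=1..m. (4 * real k ^ 2) / (4 * real k ^ 2 - 1))"
  define c where "c = real (2 * m choose m)"
  define c' where "c' = real (2 * Suc m choose Suc m)"
  have "real (Suc m * (2 * Suc m choose Suc m)) = real (2 * (2 * m + 1) * (2 * m choose m))"
    by (simp only: Suc_times_central_binomial)
  then have rec: "(real m + 1) * c' = 2 * (2 * real m + 1) * c"
    unfolding c_def c'_def by (simp only: of_nat_mult of_nat_Suc of_nat_add of_nat_1 of_nat_numeral add.commute)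
  have "4 * (real m + 1) ^ 2 - 1 = (2 * real m + 1) * (2 * real m + 3)"
    by (simp add: power2_eq_square algebra_simps)
  then have "4 * (real m + 1) ^ 2 / (4 * (real m + 1) ^ 2 - 1) * (c' ^ 2 * (2 * real m + 3)) =
      4 * ((real m + 1) * c') ^ 2 / (2 * real m + 1)"
    by (simp add: divide_simps power_mult_distrib)
  also have "\<dots> = 16 * (c ^ 2 * (2 * real m + 1))"
    unfolding rec by (simp add: power2_eq_square divide_simps) (simp add: algebra_simps)
  finally have "P * (4 * (real m + 1) ^ 2 / (4 * (real m + 1) ^ 2 - 1)) * (c' ^ 2 * (2 * real m + 3)) =
      16 * (P * (c ^ 2 * (2 * real m + 1)))"
    by (simp only: mult.assoc mult.left_commute[of P])
  then show ?case
    using Suc by (simp add: P_def c_def c'_def algebra_simps)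
qed simp

text \<open>Every factor is at least 1, so the partial products increase to their limit.\<close>

lemma wallis_product_le: "(\<Prod>k=1..m. (4 * real k ^ 2) / (4 * real k ^ 2 - 1)) \<le> pi / 2"
proof (rule incseq_le[OF _ wallis])
  show "incseq (\<lambda>m. \<Prod>k=1..m. (4 * real k ^ 2) / (4 * real k ^ 2 - 1))"
  proof (rule incseq_SucI)
    fix m
    have "1 \<le> 4 * real k ^ 2" if "k \<ge> 1" for k
    proof -
      have "1 \<le> real k ^ 2" using that by (intro one_le_power) simp
      then show ?thesis by linarith
    qed
    then have "0 \<le> (\<Prod>k=1..m. (4 * real k ^ 2) / (4 * real k ^ 2 - 1))"
      by (intro prod_nonneg) auto
    moreover have "1 < 4 * real (Suc m) ^ 2"
      using one_le_power[of "real (Suc m)" 2] by linarith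
    then have "1 \<le> 4 * real (Suc m) ^ 2 / (4 * real (Suc m) ^ 2 - 1)"
      by (simp add: field_simps)
    ultimately show "(\<Prod>k=1..m. (4 * real k ^ 2) / (4 * real k ^ 2 - 1)) \<le>
        (\<Prod>k=1..Suc m. (4 * real k ^ 2) / (4 * real k ^ 2 - 1))"
      using mult_left_mono[of 1 "4 * real (Suc m) ^ 2 / (4 * real (Suc m) ^ 2 - 1)"
          "\<Prod>k=1..m. (4 * real k ^ 2) / (4 * real k ^ 2 - 1)"]
      by (simp del: of_nat_Suc)
  qed
qed

lemma central_binomial_sq_ge:
  "2 / pi * 16 ^ m \<le> real (2 * m choose m) ^ 2 * (2 * real m + 1)"
proof -
  have "16 ^ m \<le> pi / 2 * (real (2 * m choose m) ^ 2 * (2 * real m + 1))"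
    unfolding wallis_product_central_binomial[symmetric]
    by (intro mult_right_mono wallis_product_le) simp
  then show ?thesis by (simp add: field_simps)
qed

text \<open>Rounding \<open>h\<close> down to an even number \<open>2 * m\<close> makes the Wallis
  bound applicable; the summand 1 pays for the rounding.\<close>

lemma sqrt_less_mean_abs_walk:
  assumes "0 < h"
  shows "sqrt (2 * real h / pi) < 1 + mean_abs_walk h"
proof -
  define m where "m = h div 2"
  \<comment> \<open>The product \<open>a * s\<close> is the target root at \<open>2 * m + 1\<close>,
    the largest possible \<open>h\<close>; for positive \<open>m\<close>, \<open>y\<close> is the
    bound on \<open>mean_abs_walk (2 * m)\<close> from \<open>mean_abs_walk_ge\<close>.\<close>
  define s where "s = sqrt (2 * real m + 1)"
  define a where "a = sqrt (2 / pi)"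
  define y where "y = 2 * real m * real (2 * m choose m) / 4 ^ m"
  have s: "1 \<le> s" "s * s = 2 * real m + 1" by (simp_all add: s_def)
  have a: "0 < a" "a < 1" using pi_gt3 by (simp_all add: a_def)
  have "a\<^sup>2 * (2 * real m)\<^sup>2 = (2 * real m / 4 ^ m)\<^sup>2 * (2 / pi * 16 ^ m)"
    using power_mult[of "4 :: real" 2 m] by (simp add: a_def power_divide power_mult_distrib flip: power_mult mult.commute[of m])
  also have "\<dots> \<le> (2 * real m / 4 ^ m)\<^sup>2 * (real (2 * m choose m) ^ 2 * (2 * real m + 1))"
    by (intro mult_left_mono central_binomial_sq_ge) simp
  also have "\<dots> = (y * s)\<^sup>2"
    using s(2) by (simp add: y_def power2_eq_square)
  finally have "(a * (2 * real m))\<^sup>2 \<le> (y * s)\<^sup>2"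
    by (simp add: power_mult_distrib)
  then have "a * (2 * real m) \<le> y * s"
    by (rule power2_le_imp_le) (use s(1) in \<open>simp add: y_def\<close>)
  \<comment> \<open>Adding \<open>a\<close> completes \<open>2 * m\<close> to \<open>s * s\<close>;
    then \<open>a < 1 \<le> s\<close> allows replacing the added \<open>a\<close> by
    \<open>s\<close>, and \<open>s\<close> cancels.\<close>
  then have "(a * s) * s \<le> y * s + a"
    by (simp add: s(2) mult.assoc algebra_simps)
  also have "\<dots> < (y + 1) * s"
    using a(2) s(1) by (simp add: algebra_simps)
  finally have "a * s < 1 + y"
    using s(1) by (simp add: add.commute)
  moreover have "y \<le> mean_abs_walk (2 * m)"
  proof (cases "m = 0")
    case True
    then show ?thesis by (simp add: y_def mean_abs_walk_nonneg)
  next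
    case False
    then have "2 * real m * real (2 * m choose m) \<le> 4 ^ m * mean_abs_walk (2 * m)"
      using mean_abs_walk_ge[of "2 * m"] by (simp add: power_mult)
    then show ?thesis by (simp add: y_def field_simps)
  qed
  moreover have "mean_abs_walk (2 * m) \<le> mean_abs_walk h"
    by (rule lift_Suc_mono_le) (simp_all add: mean_abs_walk_Suc m_def)
  moreover have "sqrt (2 * real h / pi) \<le> a * s"
  proof -
    have "h \<le> 2 * m + 1" unfolding m_def by linarith
    then have "real h \<le> 2 * real m + 1" by linarith
    then show ?thesis
      by (simp add: a_def s_def divide_right_mono flip: real_sqrt_mult)
  qed
  ultimately show ?thesis by linarith
qed

section \<open>The determinant and ratio bounds at order \<open>h + d\<close>\<close>

theorem theorem3p4:
  fixes d h n :: nat and \<mu> :: real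
  assumes "d \<ge> 1" and "h \<ge> 4"
    and "\<exists>A. hadamard_matrix h A"
    and "n = h + d"
    and "\<mu> = 1 + real h / 2 ^ h * real (h choose (h div 2))"
  shows "max_det n \<ge> real h powr (real h / 2) * \<mu> ^ d * (1 - (real d)\<^sup>2 / \<mu>) \<and>
    max_det_ratio n >
      (2 / (pi * exp 1)) powr (real d / 2) * (1 - (real d)\<^sup>2 * sqrt (pi / (2 * real h)))"
proof
  have h: "0 < h" "0 < real h" using assms(2) by simp_all
  define H where "H = real h powr (real h / 2)"
  define q where "q = 1 + mean_abs_walk h"
  have H: "0 < H" "H \<le> max_det h"
    using max_det_hadamard h assms(3) by (auto simp: H_def)
  have q: "1 \<le> q" by (simp add: q_def mean_abs_walk_nonneg)
  have \<mu>: "1 \<le> \<mu>" by (simp add: assms(5))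
  have "H * q ^ d \<le> max_det h * q ^ d"
    using H q by (intro mult_right_mono) auto
  also have "\<dots> \<le> max_det n"
    unfolding assms(4) q_def using H by (intro max_det_add) simp
  finally have main: "H * q ^ d \<le> max_det n" .
  \<comment> \<open>The right side is \<open>h\<close> rounded up to an even number, so the walk
    estimate dominates \<open>\<mu> - 1\<close> for either parity.\<close>
  have "real h \<le> 2 * real (h - h div 2)" by linarith
  then have "real h * real (h choose (h div 2)) \<le> 2 ^ h * mean_abs_walk h"
    using mean_abs_walk_ge[OF h(1)] by (meson mult_right_mono of_nat_0_le_iff order_trans)
  then have "\<mu> \<le> q"
    by (simp add: assms(5) q_def field_simps)
  then have "\<mu> ^ d \<le> q ^ d"
    using \<mu> by (intro power_mono) auto
  moreover have "\<mu> ^ d * (1 - (real d)\<^sup>2 / \<mu>) \<le> \<mu> ^ d"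
    using \<mu> by (intro mult_left_le) auto
  ultimately have "H * (\<mu> ^ d * (1 - (real d)\<^sup>2 / \<mu>)) \<le> H * q ^ d"
    using H by (intro mult_left_mono) auto
  then show "real h powr (real h / 2) * \<mu> ^ d * (1 - (real d)\<^sup>2 / \<mu>) \<le> max_det n"
    using main by (simp add: H_def mult.assoc)

  \<comment> \<open>Bounding \<open>n = h * (1 + d / h)\<close> by \<open>h * exp (d / h)\<close>
    and raising to the power \<open>n / 2\<close> gives the exponent \<open>d / 2 + x\<close>;
    \<open>x\<close> is the excess.\<close>
  define x where "x = (real d)\<^sup>2 / (2 * real h)"
  have "real n \<le> real h * exp (real d / real h)"
  proof -
    have "real n = real h * (1 + real d / real h)"
      using h by (simp add: assms(4) field_simps)
    also have "\<dots> \<le> real h * exp (real d / real h)"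
      by (intro mult_left_mono exp_ge_add_one_self) simp
    finally show ?thesis .
  qed
  then have "real n powr (real n / 2) \<le> (real h * exp (real d / real h)) powr (real n / 2)"
    by (intro powr_mono2) auto
  also have "\<dots> = H * real h powr (real d / 2) * exp (real d / real h * (real n / 2))"
    by (simp add: powr_mult exp_powr_real H_def assms(4) add_divide_distrib flip: powr_add)
  also have "real d / real h * (real n / 2) = real d / 2 + x"
    using h by (simp add: assms(4) x_def field_simps power2_eq_square)
  also have "H * real h powr (real d / 2) * exp (real d / 2 + x) =
      H * (real h * exp 1) powr (real d / 2) * exp x"
    by (simp add: powr_mult exp_powr_real exp_add)
  finally have den: "real n powr (real n / 2) \<le> H * (real h * exp 1) powr (real d / 2) * exp x" .

  \<comment> \<open>The constant is split into one factor \<open>sqrt (2 * h / pi)\<close> per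
    border, to be compared with \<open>q\<close>.\<close>
  have "2 / (pi * exp 1) = 2 * real h / pi / (real h * exp 1)"
    using h by (simp add: field_simps)
  then have base: "(2 / (pi * exp 1)) powr (real d / 2) =
      sqrt (2 * real h / pi) ^ d / (real h * exp 1) powr (real d / 2)"
    using h powr_divide[of "2 * real h / pi" "real h * exp 1" "real d / 2"]
    by (simp add: powr_powr flip: powr_half_sqrt powr_realpow)
  \<comment> \<open>This leads to a bracket of at most \<open>1 - x \<le> exp (- x)\<close>, which
    accounts for the \<open>exp x\<close> in the denominator bound.\<close>
  have "1 \<le> pi * (2 * real h)"
    using mult_mono[of 1 pi 1 "2 * real h"] h pi_gt3 by simp
  then have "1 / (2 * real h) \<le> sqrt (pi / (2 * real h))"
    using h by (intro real_le_rsqrt) (simp add: field_simps power2_eq_square)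
  then have "(real d)\<^sup>2 * (1 / (2 * real h)) \<le> (real d)\<^sup>2 * sqrt (pi / (2 * real h))"
    by (intro mult_left_mono) auto
  then have "1 - (real d)\<^sup>2 * sqrt (pi / (2 * real h)) \<le> 1 - x"
    by (simp add: x_def)
  also have "\<dots> \<le> exp (- x)"
    using exp_ge_add_one_self[of "- x"] by simp
  finally have "(2 / (pi * exp 1)) powr (real d / 2) * (1 - (real d)\<^sup>2 * sqrt (pi / (2 * real h)))
      \<le> (2 / (pi * exp 1)) powr (real d / 2) * exp (- x)"
    by (intro mult_left_mono) auto
  also have "(2 / (pi * exp 1)) powr (real d / 2) * exp (- x) =
      sqrt (2 * real h / pi) ^ d / (real h * exp 1) powr (real d / 2) * exp (- x)"
    by (simp only: base)
  \<comment> \<open>Strictness enters here; \<open>d \<ge> 1\<close> carries it through the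
    power.\<close>
  also have "sqrt (2 * real h / pi) ^ d / (real h * exp 1) powr (real d / 2) * exp (- x)
      < q ^ d / (real h * exp 1) powr (real d / 2) * exp (- x)"
    using sqrt_less_mean_abs_walk[OF h(1)] h assms(1)
    by (intro mult_strict_right_mono divide_strict_right_mono power_strict_mono) (auto simp: q_def)
  also have "\<dots> = (H * q ^ d) / (H * (real h * exp 1) powr (real d / 2) * exp x)"
    using H by (simp add: exp_minus field_simps)
  also have "\<dots> \<le> max_det n / real n powr (real n / 2)"
  proof (intro frac_le)
    have "0 \<le> H * q ^ d" using H q by simp
    then show "0 \<le> max_det n" using main by simp
  qed (use main den h in \<open>simp_all add: assms(4)\<close>)
  finally show "(2 / (pi * exp 1)) powr (real d / 2) * (1 - (real d)\<^sup>2 * sqrt (pi / (2 * real h)))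
      < max_det_ratio n"
    by (simp add: max_det_ratio_def)
qed

end
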